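(* Let $k\ge2$, $n\ge1$, $w\ge1$ be integers and $0\le\Delta\le\frac{n}{2(k-1)}$ a real number. Suppose there is a length-$n$ width-$w$ read-once branching program over alphabet $[k]$ computing $\mathsf{ApproxCount}_{k\text{-counter}}[n,\Delta]$. Let $m$ be the largest integer with $m\le n-1$ and $\binom{m+k-1}{k-1}\le w$. Then $$\binom{m+k}{k}+(n-m-1)w\ \ge\ \binom{n-2(k-1)\Delta+k-1}{k}.$$
   Context: A length-$n$ read-once branching program (ROBP) over a finite alphabet $\Sigma$ is a directed layered multigraph with layers $V_0,\dots,V_n$, $V_0=\{v_{\mathrm{start}}\}$; for $0\le i\le n-1$ each vertex of $V_i$ has $|\Sigma|$ outgoing edges into $V_{i+1}$ labeled by distinct elements of $\Sigma$; vertices of $V_n$ have no outgoing edges and each is labeled with an output; every vertex is reachable from $v_{\mathrm{start}}$ by some input. An input $x\in\Sigma^n$ follows the path from $v_{\mathrm{start}}$ using at step $i$ the edge labeled $x_i$, and the program outputs the label of the final vertex. The width is $\max_i|V_i|$. For integers $k\ge2$, $n\ge1$ and real $\Delta\ge0$, $\mathsf{ApproxCount}_{k\text{-counter}}[n,\Delta]$: on input $x\in[k]^n$, output reals $(\hat S_1,\dots,\hat S_k)$ with $|\hat S_j-\#\{i: x_i=j\}|\le\Delta$ for all $j\in[k]$; a program computes it if its output is valid on every input. For real $x$ and integer $j\ge1$, $\binom{x}{j}$ denotes $x(x-1)\cdots(x-j+1)/j!$ (for $x\ge j-1$). *)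

theory Defs
  imports Complex_Main "HOL-Library.Disjoint_Sets"
begin

text \<open>
  Read-once branching programs.  Since the edges leaving a vertex carry each alphabet symbol
  exactly once, the labelled multigraph is given by a transition function: \<open>edge_to B v a\<close> is the
  head of the edge leaving \<open>v\<close> with label \<open>a\<close>.  The layers are disjoint, so the transition
  function needs no layer index.  The values of \<open>edge_to B v a\<close> for \<open>v\<close> in the last layer (or
  outside the graph) or \<open>a\<close> outside the alphabet, and of \<open>outlabel B v\<close> for \<open>v\<close> outside the last
  layer, carry no meaning.
\<close>

record ('v, 'a, 'o) robp =
  layer :: "nat \<Rightarrow> 'v set"
  start :: 'v
  edge_to :: "'v \<Rightarrow> 'a \<Rightarrow> 'v"
  outlabel :: "'v \<Rightarrow> 'o"

definition inputs :: "'a set \<Rightarrow> nat \<Rightarrow> 'a list set" where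
  "inputs \<Sigma> n = {x. length x = n \<and> set x \<subseteq> \<Sigma>}"

definition vertex_after :: "('v, 'a, 'o) robp \<Rightarrow> 'a list \<Rightarrow> nat \<Rightarrow> 'v" where
  "vertex_after B x i = foldl (edge_to B) (start B) (take i x)"

definition is_robp :: "'a set \<Rightarrow> nat \<Rightarrow> ('v, 'a, 'o) robp \<Rightarrow> bool" where
  "is_robp \<Sigma> n B \<longleftrightarrow>
     finite \<Sigma> \<and>
     (\<forall>i\<le>n. finite (layer B i)) \<and>
     disjoint_family_on (layer B) {..n} \<and>
     layer B 0 = {start B} \<and>
     (\<forall>i<n. \<forall>v\<in>layer B i. \<forall>a\<in>\<Sigma>. edge_to B v a \<in> layer B (Suc i)) \<and>
     (\<forall>i\<le>n. \<forall>v\<in>layer B i. \<exists>x\<in>inputs \<Sigma> n. vertex_after B x i = v)"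

definition robp_width :: "nat \<Rightarrow> ('v, 'a, 'o) robp \<Rightarrow> nat" where
  "robp_width n B = Max ((\<lambda>i. card (layer B i)) ` {..n})"

definition robp_output :: "nat \<Rightarrow> ('v, 'a, 'o) robp \<Rightarrow> 'a list \<Rightarrow> 'o" where
  "robp_output n B x = outlabel B (vertex_after B x n)"

definition robp_computes ::
    "'a set \<Rightarrow> nat \<Rightarrow> ('v, 'a, 'o) robp \<Rightarrow> ('a list \<Rightarrow> 'o \<Rightarrow> bool) \<Rightarrow> bool" where
  "robp_computes \<Sigma> n B valid \<longleftrightarrow> (\<forall>x\<in>inputs \<Sigma> n. valid x (robp_output n B x))"

text \<open>
  The \<open>k\<close>-counter task: \<open>[k]\<close> is \<open>{1..k}\<close>, and an output tuple \<open>(S 1, \<dots>, S k)\<close> of reals is a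
  function \<open>S\<close>, of which only the values on \<open>{1..k}\<close> are considered.
\<close>

definition approx_count_valid ::
    "nat \<Rightarrow> real \<Rightarrow> nat list \<Rightarrow> (nat \<Rightarrow> real) \<Rightarrow> bool" where
  "approx_count_valid k \<Delta> x S \<longleftrightarrow>
     (\<forall>j\<in>{1..k}. \<bar>S j - real (count_list x j)\<bar> \<le> \<Delta>)"

end

theory Submission
  imports Defs
begin

text \<open>
  Give each vertex \<open>v\<close> the vector \<open>\<ell> v\<close> of the minimal counts \<open>\<ell>\<^sub>j v\<close> of the symbols \<open>j\<close> over the
  inputs leading to \<open>v\<close>. Reading \<open>a\<close> raises only coordinate \<open>a\<close>, and by at most one. At a final
  vertex all counts of a symbol differ by at most \<open>2 \<Delta>\<close>; comparing with an input that attains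
  \<open>\<ell>\<^sub>j\<close> for one \<open>j\<close> shows that the coordinates of \<open>\<ell>\<close> sum to at least \<open>N = n - 2 (k - 1) \<Delta>\<close>.
  Hence every \<open>c \<in> \<nat>\<^sup>k\<close> with sum below \<open>N\<close> equals \<open>\<ell> v\<close> for some vertex \<open>v\<close> before the
  last layer: always feed a symbol whose coordinate is still below \<open>c\<close>. Such a \<open>v\<close> in layer \<open>i\<close> has
  \<open>\<ell>\<close>-sum at most \<open>i\<close>, so the layers up to \<open>m\<close> account for at most as many \<open>c\<close> as there are vectors
  of sum at most \<open>m\<close>, and each later layer accounts for at most \<open>w\<close>.
\<close>

definition reaching :: "'a set \<Rightarrow> ('v, 'a, 'o) robp \<Rightarrow> nat \<Rightarrow> 'v \<Rightarrow> 'a list set" where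
  "reaching \<Sigma> B i v = {x \<in> inputs \<Sigma> i. vertex_after B x i = v}"

text \<open>Each symbol is minimised separately, so no single input need attain all coordinates at
  once.\<close>

definition min_count :: "'a set \<Rightarrow> ('v, 'a, 'o) robp \<Rightarrow> nat \<Rightarrow> 'v \<Rightarrow> 'a \<Rightarrow> nat" where
  "min_count \<Sigma> B i v a = (INF x\<in>reaching \<Sigma> B i v. count_list x a)"

lemma min_count_le: "x \<in> reaching \<Sigma> B i v \<Longrightarrow> min_count \<Sigma> B i v a \<le> count_list x a"
  unfolding min_count_def by (intro cINF_lower) auto

lemma min_count_attained:
  assumes "reaching \<Sigma> B i v \<noteq> {}"
  obtains x where "x \<in> reaching \<Sigma> B i v" "count_list x a = min_count \<Sigma> B i v a"
proof -
  have "min_count \<Sigma> B i v a \<in> (\<lambda>x. count_list x a) ` reaching \<Sigma> B i v"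
    unfolding min_count_def using assms by (intro Inf_nat_def1) auto
  then show thesis using that by auto
qed

lemma reaching_snoc:
  assumes "x \<in> reaching \<Sigma> B i v" "a \<in> \<Sigma>"
  shows "x @ [a] \<in> reaching \<Sigma> B (Suc i) (edge_to B v a)"
  using assms by (auto simp: reaching_def inputs_def vertex_after_def)

text \<open>Append \<open>a\<close> to an input attaining the minimum for \<open>b\<close>. Other
  edges into the same vertex may make the new minimum smaller still.\<close>

lemma min_count_step:
  assumes "reaching \<Sigma> B i v \<noteq> {}" "a \<in> \<Sigma>"
  shows "min_count \<Sigma> B (Suc i) (edge_to B v a) b
    \<le> min_count \<Sigma> B i v b + (if b = a then 1 else 0)"
proof -
  obtain x where x: "x \<in> reaching \<Sigma> B i v" "count_list x b = min_count \<Sigma> B i v b"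
    using min_count_attained[OF assms(1)] .
  show ?thesis
    using min_count_le[OF reaching_snoc[OF x(1) assms(2)], of b] x(2) by auto
qed

lemma reaching_nonempty:
  assumes "is_robp \<Sigma> n B" "i \<le> n" "v \<in> layer B i"
  shows "reaching \<Sigma> B i v \<noteq> {}"
proof -
  obtain x where x: "x \<in> inputs \<Sigma> n" "vertex_after B x i = v"
    using assms unfolding is_robp_def by blast
  have "take i x \<in> reaching \<Sigma> B i v"
    using x assms(2) set_take_subset[of i x]
    by (auto simp: reaching_def inputs_def vertex_after_def)
  then show ?thesis by auto
qed

lemma sum_count_list_reaching:
  assumes "finite \<Sigma>" "x \<in> reaching \<Sigma> B i v"
  shows "sum (count_list x) \<Sigma> = i"
  using assms sum_count_set[of x \<Sigma>] by (simp add: reaching_def inputs_def)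

lemma sum_min_count_le:
  assumes "is_robp \<Sigma> n B" "i \<le> n" "v \<in> layer B i"
  shows "sum (min_count \<Sigma> B i v) \<Sigma> \<le> i"
proof -
  obtain x where x: "x \<in> reaching \<Sigma> B i v"
    using reaching_nonempty[OF assms] by auto
  have "sum (min_count \<Sigma> B i v) \<Sigma> \<le> sum (count_list x) \<Sigma>"
    by (intro sum_mono min_count_le x)
  then show ?thesis
    using sum_count_list_reaching[OF _ x] assms(1) by (simp add: is_robp_def)
qed

lemma min_count_surj:
  assumes B: "is_robp \<Sigma> n B"
    and last: "\<And>v. v \<in> layer B n \<Longrightarrow> \<exists>a\<in>\<Sigma>. c a < min_count \<Sigma> B n v a"
  shows "\<exists>i<n. \<exists>v\<in>layer B i. \<forall>a\<in>\<Sigma>. min_count \<Sigma> B i v a = c a"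
proof (rule ccontr)
  assume none: "\<not> ?thesis"
  \<comment> \<open>Invariant of the greedy walk: the vector at the current vertex stays
    coordinatewise at most \<open>c\<close>. In layer \<open>n\<close> this contradicts
    \<open>last\<close>.\<close>
  have "\<exists>v\<in>layer B i. \<forall>a\<in>\<Sigma>. min_count \<Sigma> B i v a \<le> c a" if "i \<le> n" for i
    using that
  proof (induction i)
    case 0
    have "[] \<in> reaching \<Sigma> B 0 (start B)"
      by (simp add: reaching_def inputs_def vertex_after_def)
    then show ?case
      using B min_count_le[of "[]" \<Sigma> B 0 "start B"] by (auto simp: is_robp_def)
  next
    case (Suc i)
    then obtain v where v: "v \<in> layer B i" "\<And>b. b \<in> \<Sigma> \<Longrightarrow> min_count \<Sigma> B i v b \<le> c b"
      by auto
    \<comment> \<open>By \<open>none\<close> the vector at \<open>v\<close> differs from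
      \<open>c\<close>, so some coordinate has room for the one unit that reading \<open>a\<close>
      may add.\<close>
    with none Suc.prems obtain a where a: "a \<in> \<Sigma>" "min_count \<Sigma> B i v a < c a"
      by (metis Suc_le_eq le_neq_implies_less)
    have "edge_to B v a \<in> layer B (Suc i)"
      using B v a Suc.prems by (auto simp: is_robp_def)
    moreover have "min_count \<Sigma> B (Suc i) (edge_to B v a) b \<le> c b" if "b \<in> \<Sigma>" for b
      using min_count_step[of \<Sigma> B i v a b] reaching_nonempty[OF B _ v(1)] Suc.prems a v(2)[OF that]
      by (auto split: if_splits)
    ultimately show ?case by blast
  qed
  from this[of n] last show False by (meson leD order_refl)
qed

lemma sum_min_count_final:
  assumes B: "is_robp {1..k} n B"
    and comp: "robp_computes {1..k} n B (approx_count_valid k \<Delta>)"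
    and "k \<ge> 1" and v: "v \<in> layer B n"
  shows "real n - 2 * (real k - 1) * \<Delta> \<le> real (sum (min_count {1..k} B n v) {1..k})"
proof -
  let ?l = "min_count {1..k} B n v"
  have ne: "reaching {1..k} B n v \<noteq> {}"
    using reaching_nonempty[OF B _ v] by simp
  have close: "\<bar>outlabel B v j - real (count_list x j)\<bar> \<le> \<Delta>"
    if "x \<in> reaching {1..k} B n v" "j \<in> {1..k}" for x j
    using comp that
    by (auto simp: robp_computes_def approx_count_valid_def robp_output_def reaching_def)
  \<comment> \<open>Coordinate 1 is exact for this \<open>x\<close>, so only the other
    \<open>k - 1\<close> symbols can lose \<open>2 * \<Delta>\<close> each.\<close>
  obtain x where x: "x \<in> reaching {1..k} B n v" "count_list x 1 = ?l 1"
    using min_count_attained[OF ne] .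
  \<comment> \<open>Both counts of \<open>j\<close> lie within \<open>\<Delta>\<close> of the same
    output label.\<close>
  have diff: "real (count_list x j) - 2 * \<Delta> \<le> real (?l j)" if "j \<in> {1..k}" for j
  proof -
    obtain y where y: "y \<in> reaching {1..k} B n v" "count_list y j = ?l j"
      using min_count_attained[OF ne] .
    show ?thesis using close[OF x(1) that] close[OF y(1) that] y(2) by linarith
  qed
  have split: "sum f {1..k} = f 1 + sum f {2..k}" for f :: "nat \<Rightarrow> real"
    using \<open>k \<ge> 1\<close> by (simp add: sum.atLeast_Suc_atMost numeral_2_eq_2)
  have "real n = (\<Sum>j\<in>{1..k}. real (count_list x j))"
    using sum_count_list_reaching[OF _ x(1)] by (metis finite_atLeastAtMost of_nat_sum)
  also have "\<dots> = real (?l 1) + (\<Sum>j\<in>{2..k}. real (count_list x j))"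
    by (simp only: split x(2))
  also have "\<dots> \<le> real (?l 1) + (\<Sum>j\<in>{2..k}. real (?l j) + 2 * \<Delta>)"
    by (intro add_left_mono sum_mono) (use diff in \<open>force simp: algebra_simps\<close>)
  also have "\<dots> = (\<Sum>j\<in>{1..k}. real (?l j)) + 2 * (real k - 1) * \<Delta>"
    using \<open>k \<ge> 1\<close> by (simp only: split) (simp add: sum.distrib of_nat_diff algebra_simps)
  finally show ?thesis by simp
qed

text \<open>Prepending the slack \<open>s - sum_list l\<close> makes the sum exactly
  \<open>s\<close> at length \<open>Suc k\<close>; then stars and bars applies.\<close>

lemma card_length_sum_list_le:
  "card {l::nat list. length l = k \<and> sum_list l \<le> s} = (s + k) choose k"
proof -
  let ?E = "{l::nat list. length l = Suc k \<and> sum_list l = s}"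
  have inj: "inj_on tl ?E"
  proof (rule inj_onI)
    fix x y assume "x \<in> ?E" "y \<in> ?E" "tl x = tl y"
    then show "x = y" by (cases x; cases y) auto
  qed
  have image: "tl ` ?E = {l. length l = k \<and> sum_list l \<le> s}"
  proof
    have "tl l \<in> {l. length l = k \<and> sum_list l \<le> s}" if "l \<in> ?E" for l
      using that by (cases l) auto
    then show "tl ` ?E \<subseteq> {l. length l = k \<and> sum_list l \<le> s}" by blast
    show "{l. length l = k \<and> sum_list l \<le> s} \<subseteq> tl ` ?E"
    proof
      fix l :: "nat list"
      assume "l \<in> {l. length l = k \<and> sum_list l \<le> s}"
      then have "(s - sum_list l) # l \<in> ?E" by simp
      then show "l \<in> tl ` ?E"
        by (rule rev_image_eqI) simp
    qed
  qed
  have "card {l::nat list. length l = k \<and> sum_list l \<le> s} = card ?E"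
    using card_image[OF inj] by (simp only: image)
  also have "\<dots> = (s + k) choose s"
    using card_length_sum_list[of "Suc k" s] by simp
  also have "\<dots> = (s + k) choose k"
    using binomial_symmetric[of s "s + k"] by simp
  finally show ?thesis .
qed

text \<open>The first assumption makes all \<open>k\<close> factors \<open>a - i\<close>
  nonnegative, so the products compare factor by factor.\<close>

lemma gbinomial_real_mono:
  fixes a b :: real
  assumes "real k \<le> a + 1" "a \<le> b"
  shows "a gchoose k \<le> b gchoose k"
  unfolding gbinomial_prod_rev
  by (intro divide_right_mono prod_mono) (use assms in auto)

lemma sum_list_map_upt_shift: "sum_list (map f [1..<Suc k]) = sum f {1..k}"
  by (simp add: sum_list_distinct_conv_sum_set atLeastLessThanSuc_atLeastAtMost del: upt_Suc)

lemma choose_le_layers: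
  assumes B: "is_robp {1..k} n B"
    and width: "\<And>i. i \<le> n \<Longrightarrow> card (layer B i) \<le> w"
    and last: "\<And>v. v \<in> layer B n \<Longrightarrow> s < sum (min_count {1..k} B n v) {1..k}"
    and "m < n"
  shows "(s + k) choose k \<le> ((m + k) choose k) + (n - m - 1) * w"
proof -
  define g where "g i v = map (min_count {1..k} B i v) [1..<Suc k]" for i v
  let ?L = "\<lambda>s. {l::nat list. length l = k \<and> sum_list l \<le> s}"
  have finL: "finite (?L m)"
    by (rule finite_subset[of _ "{l. set l \<subseteq> {..m} \<and> length l = k}"])
      (auto intro: finite_lists_length_eq order_trans[OF member_le_sum_list])
  \<comment> \<open>The walk meets each vector before layer \<open>n\<close>, which leaves
    \<open>n - m - 1\<close> layers beyond \<open>m\<close>.\<close>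
  have "?L s \<subseteq> ?L m \<union> (\<Union>i\<in>{m<..<n}. g i ` layer B i)"
  proof
    fix l assume "l \<in> ?L s"
    then have l: "length l = k" "sum_list l \<le> s" by auto
    define c where "c j = l ! (j - 1)" for j
    have lc: "l = map c [1..<Suc k]"
      by (rule nth_equalityI) (use l in \<open>auto simp: c_def simp del: upt_Suc\<close>)
    have sumc: "sum_list l = sum c {1..k}"
      by (subst lc) (rule sum_list_map_upt_shift)
    have "\<exists>a\<in>{1..k}. c a < min_count {1..k} B n v a" if "v \<in> layer B n" for v
    proof (rule ccontr)
      assume "\<not> ?thesis"
      then have "sum (min_count {1..k} B n v) {1..k} \<le> sum c {1..k}"
        by (intro sum_mono) (auto simp: not_less)
      with last[OF that] l sumc show False by simp
    qed
    then obtain i v where iv: "i < n" "v \<in> layer B i"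
      and c: "\<And>a. a \<in> {1..k} \<Longrightarrow> min_count {1..k} B i v a = c a"
      using min_count_surj[OF B] by blast
    have "l = g i v"
      unfolding g_def by (subst lc) (use c in \<open>auto simp del: upt_Suc\<close>)
    moreover have "sum_list l \<le> i"
      using sum_min_count_le[OF B _ iv(2)] iv(1) c sumc by simp
    ultimately show "l \<in> ?L m \<union> (\<Union>i\<in>{m<..<n}. g i ` layer B i)"
      using iv l by (cases "i \<le> m") auto
  qed
  moreover have finV: "finite (layer B i)" if "i \<le> n" for i
    using B that by (simp add: is_robp_def)
  ultimately have "card (?L s) \<le> card (?L m \<union> (\<Union>i\<in>{m<..<n}. g i ` layer B i))"
    using finL by (intro card_mono) auto
  also have "\<dots> \<le> card (?L m) + card (\<Union>i\<in>{m<..<n}. g i ` layer B i)"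
    by (rule card_Un_le)
  also have "card (\<Union>i\<in>{m<..<n}. g i ` layer B i) \<le> (\<Sum>i\<in>{m<..<n}. card (g i ` layer B i))"
    by (rule card_UN_le) simp
  also have "\<dots> \<le> (\<Sum>i\<in>{m<..<n}. w)"
    by (intro sum_mono order_trans[OF card_image_le] width finV) auto
  finally show ?thesis
    by (simp add: card_length_sum_list_le)
qed

theorem theorem4p1:
  fixes k n w m :: nat and \<Delta> :: real
    and B :: "('v, nat, nat \<Rightarrow> real) robp"
  assumes "k \<ge> 2" and "n \<ge> 1" and "w \<ge> 1"
    and "0 \<le> \<Delta>" and "\<Delta> \<le> real n / (2 * (real k - 1))"
    and "is_robp {1..k} n B" and "robp_width n B = w"
    and "robp_computes {1..k} n B (approx_count_valid k \<Delta>)"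
    and "m = (GREATEST m. m \<le> n - 1 \<and> ((m + k - 1) choose (k - 1)) \<le> w)"
  shows "real ((m + k) choose k) + (real n - real m - 1) * real w
           \<ge> (real n - 2 * (real k - 1) * \<Delta> + real k - 1) gchoose k"
proof -
  define N where "N = real n - 2 * (real k - 1) * \<Delta>"
  have N: "0 \<le> N"
    using assms(1,5) by (simp add: N_def field_simps)
  \<comment> \<open>The value 0 qualifies because \<open>(k - 1) choose (k - 1) = 1 \<le> w\<close>,
    so the greatest element exists.\<close>
  have "m \<le> n - 1 \<and> ((m + k - 1) choose (k - 1)) \<le> w"
    unfolding assms(9)
    by (rule GreatestI_nat[where k = 0 and b = "n - 1"]) (use \<open>w \<ge> 1\<close> in auto)
  then have "m < n" using \<open>n \<ge> 1\<close> by linarith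
  have "N + real k - 1 gchoose k \<le> real ((m + k) choose k) + (real n - real m - 1) * real w"
  \<comment> \<open>No natural number lies strictly below \<open>N = 0\<close>; there the
    generalized binomial vanishes and the other side is nonnegative.\<close>
  proof (cases "N = 0")
    case True
    have "real (k - 1) gchoose k = 0"
      using \<open>k \<ge> 2\<close> by (subst binomial_gbinomial[symmetric]) (simp add: binomial_eq_0)
    then show ?thesis
      using True \<open>m < n\<close> \<open>k \<ge> 2\<close> by (simp add: of_nat_diff)
  next
    case False
    \<comment> \<open>The largest natural number strictly below \<open>N\<close>: strictness puts
      all final sums above \<open>s\<close>, and \<open>N \<le> s + 1\<close> gives
      \<open>N + k - 1 \<le> s + k\<close>.\<close>
    define s where "s = nat \<lceil>N\<rceil> - 1"
    have "1 \<le> nat \<lceil>N\<rceil>" using False N by linarith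
    then have s: "real s < N" "N \<le> real s + 1"
      unfolding s_def by linarith+
    have "s < sum (min_count {1..k} B n v) {1..k}" if "v \<in> layer B n" for v
      using sum_min_count_final[OF assms(6,8) _ that] \<open>k \<ge> 2\<close> s(1)
      unfolding N_def by linarith
    moreover have "card (layer B i) \<le> w" if "i \<le> n" for i
      using assms(7) that unfolding robp_width_def by (metis Max_ge atMost_iff finite_atMost
          finite_imageI image_eqI)
    ultimately have "(s + k) choose k \<le> ((m + k) choose k) + (n - m - 1) * w"
      using choose_le_layers[OF assms(6)] \<open>m < n\<close> by blast
    moreover have "N + real k - 1 gchoose k \<le> real (s + k) gchoose k"
      by (rule gbinomial_real_mono) (use N s in auto)
    moreover have "real (n - m - 1) = real n - real m - 1"
      using \<open>m < n\<close> by linarith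
    ultimately show ?thesis
      by (smt (verit) binomial_gbinomial of_nat_add of_nat_le_iff of_nat_mult)
  qed
  then show ?thesis by (simp add: N_def)
qed

end
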